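(* Let $d,k\ge 1$, let $P\subseteq\mathbb{R}^d$ be a $d$-dimensional lattice polytope with $h^*$-vector $(h_0^*(P),\dots,h_d^*(P))$, and let $\mathbf{P}=(P,\dots,P)$ be the collection of $k$ copies of $P$. Then $$\mathrm{ME}_{\mathbf{P}}(n)=\sum_{j=0}^d\left(\sum_{i=0}^k(-1)^{k-i}\binom{k}{i}\binom{in+d-j}{d}\right)h_j^*(P).$$ In particular, $$\mathrm{DMV}(\mathbf{P})=\sum_{j=0}^d\binom{d-j}{d-k}h_j^*(P).$$
   Context: A lattice polytope in $\mathbb{R}^d$ is the convex hull of a nonempty finite subset of $\mathbb{Z}^d$. For a lattice polytope $P$, $E_P(n)$ is its Ehrhart polynomial, i.e. the polynomial with $E_P(n)=|nP\cap\mathbb{Z}^d|$ for all integers $n\ge 0$. For a $d$-dimensional lattice polytope $P\subseteq\mathbb{R}^d$, the $h^*$-vector $(h_0^*(P),\dots,h_d^*(P))$ is defined by $$E_P(n)=\sum_{j=0}^d h_j^*(P)\binom{n+d-j}{d}.$$ For lattice polytopes $P_1,\dots,P_k\subseteq\mathbb{R}^d$ and $J\subseteq[k]=\{1,\dots,k\}$ put $P_J:=\sum_{j\in J}P_j$ (Minkowski sum), with $P_\emptyset=\{0\}$. The discrete mixed volume is $$\mathrm{DMV}(P_1,\dots,P_k):=\sum_{J\subseteq[k]}(-1)^{k-|J|}\,|P_J\cap\mathbb{Z}^d|,$$ and the mixed Ehrhart polynomial is $$\mathrm{ME}_{P_1,\dots,P_k}(n):=\mathrm{DMV}(nP_1,\dots,nP_k)=\sum_{J\subseteq[k]}(-1)^{k-|J|}E_{P_J}(n)\in\mathbb{Q}[n].$$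 The binomial coefficient $\binom{x}{d}=x(x-1)\cdots(x-d+1)/d!$ is regarded as a polynomial in $x$, and $\binom{m}{\ell}=0$ for $\ell<0$. *)

theory Defs
  imports "HOL-Analysis.Analysis" "HOL-Library.Set_Algebras"
    "HOL-Computational_Algebra.Polynomial"
begin

definition lattice_points :: "(real ^ 'n) set \<Rightarrow> (real ^ 'n) set" where
  "lattice_points S = {x \<in> S. \<forall>i. x $ i \<in> \<int>}"

definition lattice_polytope :: "(real ^ 'n) set \<Rightarrow> bool" where
  "lattice_polytope P \<longleftrightarrow>
     (\<exists>V. finite V \<and> V \<noteq> {} \<and> V \<subseteq> lattice_points UNIV \<and> P = convex hull V)"

definition dilate :: "nat \<Rightarrow> (real ^ 'n) set \<Rightarrow> (real ^ 'n) set" where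
  "dilate n P = (\<lambda>x. real n *\<^sub>R x) ` P"

definition is_ehrhart_poly :: "(real ^ 'n) set \<Rightarrow> rat poly \<Rightarrow> bool" where
  "is_ehrhart_poly P E \<longleftrightarrow>
     (\<forall>n::nat. poly E (of_nat n) = of_nat (card (lattice_points (dilate n P))))"

text \<open>
  The relation "\<open>(h 0, \<dots>, h d)\<close> is the \<open>h\<^sup>*\<close>-vector of \<open>P\<close>" for \<open>P\<close> of full dimension
  \<open>d = CARD('n)\<close>; the values \<open>h j\<close> for \<open>j > d\<close> are irrelevant. The binomial coefficients
  are polynomials in \<open>x\<close>, so the defining equation is an identity of polynomials.
  The Ehrhart polynomial \<open>E\<close> is unique, since its values at all natural numbers are prescribed,
  and so are \<open>h 0, \<dots>, h d\<close>, since these binomial coefficients are linearly independent.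
\<close>
definition is_hstar_vector :: "(real ^ 'n) set \<Rightarrow> (nat \<Rightarrow> rat) \<Rightarrow> bool" where
  "is_hstar_vector P h \<longleftrightarrow>
     (\<exists>E. is_ehrhart_poly P E \<and>
        (\<forall>x::rat. poly E x =
           (\<Sum>j=0..CARD('n). h j * ((x + of_nat CARD('n) - of_nat j) gchoose CARD('n)))))"

text \<open>
  For a family \<open>P 1, \<dots>, P k\<close>, the term \<open>sum P J\<close> is the Minkowski sum (addition of sets is
  elementwise), and \<open>sum P {} = {0}\<close>.
\<close>
definition discrete_mixed_volume :: "nat \<Rightarrow> (nat \<Rightarrow> (real ^ 'n) set) \<Rightarrow> int" where
  "discrete_mixed_volume k P =
     (\<Sum>J\<in>Pow {1..k}. (-1) ^ (k - card J) * int (card (lattice_points (sum P J))))"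

definition mixed_ehrhart_poly :: "nat \<Rightarrow> (nat \<Rightarrow> (real ^ 'n) set) \<Rightarrow> rat poly" where
  "mixed_ehrhart_poly k P =
     (THE M. \<forall>n::nat. poly M (of_nat n) =
        of_int (discrete_mixed_volume k (\<lambda>i. dilate n (P i))))"

end

(* The sum of j copies of a convex set is its j-th dilate, so ME is the alternating sum of
   binomial(k, i) * E_P(i n), that is, the k-th finite difference at 0 of i |-> E_P(i n). For
   n = 1 each difference step lowers binomial(x + d - j, d) to binomial(x + d - j, d - 1) by
   Pascal's rule. *)
theory Submission
  imports Defs
begin

lemma dilate_Suc_0 [simp]: "dilate (Suc 0) P = P"
  by (simp add: dilate_def)

lemma dilate_dilate: "dilate m (dilate n P) = dilate (m * n) P"
  by (simp add: dilate_def image_image)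

text \<open>Here \<open>0\<close> is the set {0}, the neutral element of Minkowski addition and thus
  the value of an empty sum. An empty \<open>P\<close> would have an empty dilate.\<close>

lemma dilate_0: "P \<noteq> {} \<Longrightarrow> dilate 0 P = 0"
  by (auto simp: dilate_def set_zero)

text \<open>Convexity gives the inclusion from right to left: a sum of points of the two dilates is
  \<open>m + n\<close> times a weighted mean of two points of \<open>P\<close>.\<close>

lemma dilate_add:
  assumes "convex P" "P \<noteq> {}"
  shows "dilate (m + n) P = dilate m P + dilate n P"
proof (cases "m + n = 0")
  case True
  then show ?thesis using assms by (simp add: dilate_0)
next
  case False
  define s where "s = real (m + n)"
  have s: "s > 0" "real m + real n = s" using False by (auto simp: s_def)
  show ?thesis
  proof
    show "dilate (m + n) P \<subseteq> dilate m P + dilate n P"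
      by (auto simp: dilate_def scaleR_left_distrib)
    show "dilate m P + dilate n P \<subseteq> dilate (m + n) P"
    proof
      fix z assume "z \<in> dilate m P + dilate n P"
      then obtain x y where xy: "x \<in> P" "y \<in> P" and z: "z = real m *\<^sub>R x + real n *\<^sub>R y"
        by (auto simp: dilate_def elim!: set_plus_elim)
      \<comment> \<open>The weights are nonnegative and add up to 1 because \<open>s = m + n\<close>
        is positive.\<close>
      have "(m / s) *\<^sub>R x + (n / s) *\<^sub>R y \<in> P"
        using \<open>convex P\<close> xy s by (intro convexD) (auto simp flip: add_divide_distrib)
      moreover have "z = s *\<^sub>R ((m / s) *\<^sub>R x + (n / s) *\<^sub>R y)"
        using s by (simp add: z scaleR_right_distrib)
      ultimately show "z \<in> dilate (m + n) P"
        unfolding dilate_def s_def by blast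
    qed
  qed
qed

lemma sum_const_eq_dilate:
  assumes "convex P" "P \<noteq> {}" "finite J"
  shows "(\<Sum>j\<in>J. P) = dilate (card J) P"
  using assms(3)
proof induction
  case empty
  then show ?case using assms by (simp add: dilate_0)
next
  case (insert j J)
  then show ?case
    using dilate_add[OF assms(1,2), of 1 "card J"] by simp
qed

lemma sum_Pow_card:
  fixes g :: "nat \<Rightarrow> 'b::comm_semiring_1"
  assumes "finite A"
  shows "(\<Sum>J\<in>Pow A. g (card J)) = (\<Sum>i=0..card A. of_nat (card A choose i) * g i)"
proof -
  have "(\<Sum>J\<in>Pow A. g (card J)) = (\<Sum>i=0..card A. \<Sum>J | J \<in> Pow A \<and> card J = i. g (card J))"
    using assms by (intro sum.group [symmetric]) (auto intro: card_mono)
  also have "\<dots> = (\<Sum>i=0..card A. of_nat (card A choose i) * g i)"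
    using assms by (intro sum.cong) (auto simp: n_subsets)
  finally show ?thesis .
qed

text \<open>By Pascal's rule, the difference of order \<open>Suc k\<close> of \<open>f\<close> at 0
  is the difference of order \<open>k\<close> of the first difference of \<open>f\<close>.\<close>

lemma alternating_binomial_sum_Suc:
  fixes f :: "nat \<Rightarrow> 'a::comm_ring_1"
  shows "(\<Sum>i=0..Suc k. (-1) ^ (Suc k - i) * of_nat (Suc k choose i) * f i) =
         (\<Sum>i=0..k. (-1) ^ (k - i) * of_nat (k choose i) * (f (Suc i) - f i))"
proof -
  let ?t = "\<lambda>i. (-1) ^ (k - i) * of_nat (k choose i) :: 'a"
  let ?u = "\<lambda>i. (-1) ^ (Suc k - i) * of_nat (k choose i) * f i"
  have "(\<Sum>i=0..Suc k. (-1) ^ (Suc k - i) * of_nat (Suc k choose i) * f i) =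
        ?u 0 + (\<Sum>i=0..k. ?t i * f (Suc i) + ?u (Suc i))"
    by (subst sum.atLeast0_atMost_Suc_shift) (simp add: algebra_simps)
  also have "\<dots> = (\<Sum>i=0..k. ?t i * f (Suc i)) + (\<Sum>i=0..Suc k. ?u i)"
    by (subst sum.atLeast0_atMost_Suc_shift) (simp add: sum.distrib algebra_simps)
  \<comment> \<open>The top term vanishes since \<open>k choose Suc k\<close> is 0; in all others
    the exponent exceeds that of \<open>?t\<close> by one, which flips the sign.\<close>
  also have "(\<Sum>i=0..Suc k. ?u i) = (\<Sum>i=0..k. - (?t i * f i))"
    by (simp add: Suc_diff_le binomial_eq_0)
  finally show ?thesis
    by (simp add: algebra_simps sum_subtractf sum_negf)
qed

text \<open>Induction on \<open>k\<close> with \<open>d\<close> arbitrary, since each difference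
  lowers \<open>d\<close> by one.\<close>

lemma alternating_binomial_sum_gbinomial:
  fixes a :: "'a::field_char_0"
  shows "(\<Sum>i=0..k. (-1) ^ (k - i) * of_nat (k choose i) * ((of_nat i + a) gchoose d)) =
         (if k \<le> d then a gchoose (d - k) else 0)"
proof (induction k arbitrary: d)
  case 0
  then show ?case by simp
next
  case (Suc k)
  show ?case
  proof (cases d)
    \<comment> \<open>The binomial is now the constant 1, so its differences vanish; this produces
      the value 0 for \<open>k > d\<close>.\<close>
    case 0
    then show ?thesis by (subst alternating_binomial_sum_Suc) simp
  next
    case (Suc e)
    have "((of_nat (Suc i) + a) gchoose d) - ((of_nat i + a) gchoose d) = (of_nat i + a) gchoose e"
      for i using gbinomial_Suc_Suc[of "of_nat i + a" e] Suc by (simp add: algebra_simps)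
    then show ?thesis
      using Suc.IH[of e] Suc by (subst alternating_binomial_sum_Suc) simp
  qed
qed

lemma poly_eq_if_eq_on_nat:
  fixes p q :: "'a::{comm_ring_1,ring_no_zero_divisors,ring_char_0} poly"
  assumes "\<And>n::nat. poly p (of_nat n) = poly q (of_nat n)"
  shows "p = q"
proof (rule ccontr)
  assume "p \<noteq> q"
  then have "finite {x. poly (p - q) x = 0}" by (intro poly_roots_finite) simp
  moreover have "range of_nat \<subseteq> {x. poly (p - q) x = 0}" using assms by auto
  moreover have "infinite (range (of_nat :: nat \<Rightarrow> 'a))"
    by (intro range_inj_infinite inj_of_nat)
  ultimately show False using finite_subset by blast
qed

text \<open>Each summand depends on \<open>J\<close> only through its size, so subsets of equal size
  are collected. General \<open>n\<close> identifies the mixed Ehrhart polynomial, and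
  \<open>n = 1\<close> gives the discrete mixed volume.\<close>

lemma discrete_mixed_volume_dilate_const:
  assumes "convex P" "P \<noteq> {}" "is_ehrhart_poly P E"
  shows "of_int (discrete_mixed_volume k (\<lambda>_. dilate n P)) =
    (\<Sum>i=0..k. (-1) ^ (k - i) * of_nat (k choose i) * poly E (of_nat i * of_nat n))"
proof -
  have conv: "convex (dilate n P)" "dilate n P \<noteq> {}"
    using assms by (auto simp: dilate_def intro: convex_scaling)
  have "of_int (discrete_mixed_volume k (\<lambda>_. dilate n P)) =
      (\<Sum>J\<in>Pow {1..k}. (-1) ^ (k - card J) * poly E (of_nat (card J * n)))"
    unfolding discrete_mixed_volume_def of_int_sum
  proof (intro sum.cong refl)
    fix J assume "J \<in> Pow {1..k}"
    then have "finite J" using finite_subset by blast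
    then show "of_int ((-1) ^ (k - card J) * int (card (lattice_points (\<Sum>_\<in>J. dilate n P)))) =
        (-1) ^ (k - card J) * poly E (of_nat (card J * n))"
      using assms(3) unfolding is_ehrhart_poly_def
      \<comment> \<open>The argument of \<open>E\<close> is kept as the single natural number
        \<open>card J * n\<close>, where the value of \<open>E\<close> is a lattice point
        count.\<close>
      by (simp add: sum_const_eq_dilate[OF conv] dilate_dilate del: of_nat_mult)
  qed
  also have "\<dots> = (\<Sum>i=0..k. of_nat (k choose i) * ((-1) ^ (k - i) * poly E (of_nat (i * n))))"
    by (subst sum_Pow_card) auto
  finally show ?thesis by (simp add: mult_ac)
qed

lemma poly_mixed_ehrhart_poly_const:
  assumes "convex P" "P \<noteq> {}" "is_ehrhart_poly P E"
  shows "poly (mixed_ehrhart_poly k (\<lambda>_. P)) x =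
    (\<Sum>i=0..k. (-1) ^ (k - i) * of_nat (k choose i) * poly E (of_nat i * x))"
proof -
  \<comment> \<open>An explicit witness for the definite description: the composition is the
    polynomial E(i x). Uniqueness holds because agreement at all naturals forces equality.\<close>
  define M where "M = (\<Sum>i=0..k. smult ((-1) ^ (k - i) * of_nat (k choose i))
    (pcompose E [:0, of_nat i:]))"
  have M: "poly M x = (\<Sum>i=0..k. (-1) ^ (k - i) * of_nat (k choose i) * poly E (of_nat i * x))" for x
    by (simp add: M_def poly_sum poly_pcompose mult_ac)
  have "mixed_ehrhart_poly k (\<lambda>_. P) = M"
    unfolding mixed_ehrhart_poly_def
    by (rule the_equality)
      (auto intro: poly_eq_if_eq_on_nat simp: M discrete_mixed_volume_dilate_const[OF assms])
  then show ?thesis by (simp add: M)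
qed

theorem proposition2p7:
  fixes P :: "(real ^ 'n) set" and h :: "nat \<Rightarrow> rat" and d k :: nat
  assumes "d = CARD('n)" and "k \<ge> 1"
    and "lattice_polytope P" and "aff_dim P = int d"
    and "is_hstar_vector P h"
  shows "(\<forall>x::rat. poly (mixed_ehrhart_poly k (\<lambda>_. P)) x =
            (\<Sum>j=0..d. (\<Sum>i=0..k. (-1) ^ (k - i) * of_nat (k choose i) *
               ((of_nat i * x + of_nat d - of_nat j) gchoose d)) * h j)) \<and>
         of_int (discrete_mixed_volume k (\<lambda>_. P)) =
            (\<Sum>j=0..d. (if k \<le> d then of_nat ((d - j) choose (d - k)) else 0) * h j)"
proof -
  have P: "convex P" "P \<noteq> {}"
    using assms(3) by (auto simp: lattice_polytope_def)
  obtain E where E: "is_ehrhart_poly P E"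
    and poly_E: "\<And>x. poly E x = (\<Sum>j=0..d. h j * ((x + of_nat d - of_nat j) gchoose d))"
    using assms(1,5) by (auto simp: is_hstar_vector_def)
  have expand: "(\<Sum>i=0..k. (-1) ^ (k - i) * of_nat (k choose i) * poly E (of_nat i * x)) =
      (\<Sum>j=0..d. (\<Sum>i=0..k. (-1) ^ (k - i) * of_nat (k choose i) *
         ((of_nat i * x + of_nat d - of_nat j) gchoose d)) * h j)" for x
    unfolding poly_E sum_distrib_left sum_distrib_right
    by (subst sum.swap) (simp add: mult_ac)
  have "of_int (discrete_mixed_volume k (\<lambda>_. P)) =
      (\<Sum>j=0..d. (\<Sum>i=0..k. (-1) ^ (k - i) * of_nat (k choose i) *
         ((of_nat i * 1 + of_nat d - of_nat j) gchoose d)) * h j)"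
    using discrete_mixed_volume_dilate_const[OF P E, of k 1] expand[of 1] by simp
  also have "\<dots> = (\<Sum>j=0..d. (if k \<le> d then of_nat ((d - j) choose (d - k)) else 0) * h j)"
  proof (intro sum.cong refl arg_cong2[where f = "(*)"])
    fix j assume "j \<in> {0..d}"
    then show "(\<Sum>i=0..k. (-1) ^ (k - i) * of_nat (k choose i) *
         ((of_nat i * 1 + of_nat d - of_nat j) gchoose d)) =
        (if k \<le> d then of_nat ((d - j) choose (d - k)) else (0::rat))"
      \<comment> \<open>As \<open>j \<le> d\<close>, the shift \<open>d - j\<close> is a natural
        number, so the generalized binomial is an ordinary one.\<close>
      using alternating_binomial_sum_gbinomial[of k "of_nat (d - j) :: rat" d]
      by (simp add: of_nat_diff add_diff_eq binomial_gbinomial)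
  qed
  finally show ?thesis
    using expand by (simp add: poly_mixed_ehrhart_poly_const[OF P E])
qed

end
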